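(* Let $A$ be a finite-dimensional algebra of degree $\leq 4$ over a field $\mathbb{K}$ of characteristic zero, having a left unit $e$ (that is, $ex=x$ for all $x\in A$). Then $A$ is power-commutative in each of the following cases: (1) $e$ is a two-sided unit and, for some fixed $p,q,r\in\{1,2\}$, $A$ satisfies the identity $(x^p,x^q,x^r)=0$ for all $x\in A$. (2) $A$ has no non-zero divisors of zero and, for some fixed $q,r\in\{1,2\}$, $A$ satisfies the identity $(x,x^q,x^r)=0$ for all $x\in A$.
   Context: An algebra over a field is a vector space with a bilinear product, not assumed associative, commutative or unital. The associator is $(x,y,z)=(xy)z-x(yz)$; $x^1=x$ and $x^2=xx$. For $x\in A$, $A(x)$ denotes the subalgebra of $A$ generated by $x$. The degree of a finite-dimensional algebra $A$ is $\max\{\dim A(y): y\in A\}$. $A$ is power-commutative if $A(x)$ is commutative for all $x\in A$. $A$ has no non-zero divisors of zero if $xy=0$ implies $x=0$ or $y=0$. *)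

theory Defs
  imports Complex_Main
begin

locale nonassoc_algebra = vector_space scale
  for scale :: "'k::field \<Rightarrow> 'a::ab_group_add \<Rightarrow> 'a" +
  fixes mult :: "'a \<Rightarrow> 'a \<Rightarrow> 'a"
  assumes linear_mult_right: "Vector_Spaces.linear scale scale (\<lambda>y. mult x y)"
    and linear_mult_left: "Vector_Spaces.linear scale scale (\<lambda>x. mult x y)"
begin

definition finite_dimensional :: bool where
  "finite_dimensional \<longleftrightarrow> (\<exists>B. finite B \<and> span B = UNIV)"

definition associator :: "'a \<Rightarrow> 'a \<Rightarrow> 'a \<Rightarrow> 'a" where
  "associator x y z = mult (mult x y) z - mult x (mult y z)"

(* Only the exponents 1 and 2 are meant to be used (algebra_power_1 and
   algebra_power_2 below); without power-associativity, higher powers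
   depend on the bracketing. *)
definition algebra_power :: "'a \<Rightarrow> nat \<Rightarrow> 'a" where
  "algebra_power x n = (if n = 2 then mult x x else x)"

lemma algebra_power_1: "algebra_power x 1 = x"
  and algebra_power_2: "algebra_power x 2 = mult x x"
  by (simp_all add: algebra_power_def)

definition subalgebra :: "'a set \<Rightarrow> bool" where
  "subalgebra S \<longleftrightarrow> subspace S \<and> (\<forall>a\<in>S. \<forall>b\<in>S. mult a b \<in> S)"

definition generated_subalgebra :: "'a \<Rightarrow> 'a set" where
  "generated_subalgebra x = \<Inter>{S. subalgebra S \<and> x \<in> S}"

lemma subalgebra_generated_subalgebra: "subalgebra (generated_subalgebra x)"
proof -
  have "subspace (generated_subalgebra x)"
    unfolding generated_subalgebra_def
    by (rule subspace_Inter) (simp add: subalgebra_def)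
  moreover have "mult a b \<in> generated_subalgebra x"
    if "a \<in> generated_subalgebra x" "b \<in> generated_subalgebra x" for a b
    using that unfolding generated_subalgebra_def subalgebra_def by blast
  ultimately show ?thesis
    by (simp add: subalgebra_def)
qed

(* The Max is over a finite set only under finite_dimensional, which has to
   be assumed wherever degree is used. *)
definition degree :: nat where
  "degree = Max (range (\<lambda>y. dim (generated_subalgebra y)))"

definition power_commutative :: bool where
  "power_commutative \<longleftrightarrow>
    (\<forall>x. \<forall>a\<in>generated_subalgebra x. \<forall>b\<in>generated_subalgebra x. mult a b = mult b a)"

definition left_unit :: "'a \<Rightarrow> bool" where
  "left_unit e \<longleftrightarrow> (\<forall>x. mult e x = x)"

definition two_sided_unit :: "'a \<Rightarrow> bool" where
  "two_sided_unit e \<longleftrightarrow> (\<forall>x. mult e x = x \<and> mult x e = x)"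

definition no_zero_divisors :: bool where
  "no_zero_divisors \<longleftrightarrow> (\<forall>x y. mult x y = 0 \<longrightarrow> x = 0 \<or> y = 0)"

definition power_associator_identity :: "nat \<Rightarrow> nat \<Rightarrow> nat \<Rightarrow> bool" where
  "power_associator_identity p q r \<longleftrightarrow>
    (\<forall>x. associator (algebra_power x p) (algebra_power x q) (algebra_power x r) = 0)"

lemma degree_le_iff:
  assumes finite_dimensional
  shows "degree \<le> n \<longleftrightarrow> (\<forall>y. dim (generated_subalgebra y) \<le> n)"
proof -
  obtain B where B: "finite B" "span B = UNIV"
    using assms unfolding finite_dimensional_def by blast
  have "dim (generated_subalgebra y) \<le> card B" for y
    by (rule dim_le_card) (simp_all add: B)
  then have "finite (range (\<lambda>y. dim (generated_subalgebra y)))"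
    by (intro finite_subset[OF _ finite_atMost[of "card B"]]) (simp add: image_subset_iff)
  then show ?thesis
    unfolding degree_def by simp
qed

end

end

theory Submission
  imports Defs
begin

text \<open>
  Substituting \<open>e + t x\<close> into the identity and comparing coefficients of powers of \<open>t\<close> gives
  \<open>(x, e, e) = 0\<close> in case (2), hence \<open>(x e - x) e = 0\<close> and \<open>e\<close> is two-sided; with a two-sided
  unit it gives \<open>(x, x, x) = 0\<close>, that is, \<open>x\<^sup>2\<close> commutes with \<open>x\<close>.

  The operator \<open>L\<^sub>x\<close> has finitely many eigenvalues, so left multiplication by some
  \<open>y = x + s e\<close> is injective. It then maps \<open>A(y)\<close> onto itself, so \<open>y u = y = y e\<close> for some
  \<open>u\<close> in \<open>A(y)\<close>, whence \<open>e = u\<close> lies in \<open>A(y)\<close> and \<open>A(x) \<subseteq> A(y)\<close>.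

  Put \<open>a = y\<close>, \<open>b = a\<^sup>2\<close>, \<open>c = a b\<close>, \<open>d = b\<^sup>2\<close>. Linearising \<open>[x\<^sup>2, x] = 0\<close> gives
  \<open>[c, a] = 0\<close>, \<open>[d, b] = 0\<close> and \<open>2 [c, b] + [d, a] = 0\<close>. As \<open>dim A(y) \<le> 4\<close>, one of
  \<open>{e, a}\<close>, \<open>{e, a, b}\<close>, \<open>{e, a, b, d}\<close>, \<open>{e, a, b, c}\<close> spans \<open>A(y)\<close>, and in each case the
  relations make the spanning set commute.
\<close>

section \<open>Independence of eigenvectors\<close>

context vector_space
begin

text \<open>Applying L - m to a relation kills the term of the eigenvalue m and multiplies each
  other coefficient by s - m, which is non-zero. So the induction hypothesis, with \<open>c\<close>
  arbitrary, removes the other terms, and then the term at m vanishes too. Indexing the eigenvectors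
  by their eigenvalues makes these distinct automatically.\<close>

lemma independent_eigenvectors:
  assumes L: "Vector_Spaces.linear scale scale L"
    and "finite S"
    and "\<And>s. s \<in> S \<Longrightarrow> v s \<noteq> 0" "\<And>s. s \<in> S \<Longrightarrow> L (v s) = s *s v s"
    and "(\<Sum>s\<in>S. c s *s v s) = 0" "s \<in> S"
  shows "c s = 0"
  using assms(2-)
proof (induction S arbitrary: c s rule: finite_induct)
  case empty
  then show ?case by simp
next
  case (insert m S)
  interpret L: Vector_Spaces.linear scale scale L by (rule L)
  have sum0: "c m *s v m + (\<Sum>s\<in>S. c s *s v s) = 0"
    using insert.prems(3) insert.hyps by simp
  have "(\<Sum>s\<in>S. (c s * (s - m)) *s v s) =
      L (c m *s v m + (\<Sum>s\<in>S. c s *s v s)) - m *s (c m *s v m + (\<Sum>s\<in>S. c s *s v s))"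
  proof -
    have "L (\<Sum>s\<in>S. c s *s v s) = (\<Sum>s\<in>S. c s *s (s *s v s))"
      using insert.prems(2) by (simp add: L.sum L.scale)
    moreover have "m *s (\<Sum>s\<in>S. c s *s v s) = (\<Sum>s\<in>S. m *s (c s *s v s))"
      by (rule scale_sum_right)
    moreover have "(\<Sum>s\<in>S. (c s * (s - m)) *s v s) =
        (\<Sum>s\<in>S. c s *s (s *s v s)) - (\<Sum>s\<in>S. m *s (c s *s v s))"
      unfolding sum_subtractf[symmetric]
      by (rule sum.cong) (simp_all add: right_diff_distrib scale_left_diff_distrib mult.commute)
    moreover have "L (c m *s v m) = m *s (c m *s v m)"
      using insert.prems(2) by (simp add: L.scale mult.commute)
    ultimately show ?thesis
      by (simp add: L.add scale_right_distrib)
  qed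
  then have "(\<Sum>s\<in>S. (c s * (s - m)) *s v s) = 0"
    using sum0 by (simp add: L.zero)
  then have S0: "c s = 0" if "s \<in> S" for s
    using insert.IH[of "\<lambda>s. c s * (s - m)" s] insert.prems(1,2) insert.hyps(2) that by auto
  then have "c m *s v m = 0"
    using sum0 by simp
  then show ?case
    using S0 insert.prems(1)[of m] insert.prems(4) by auto
qed

end

section \<open>Comparing coefficients in characteristic zero\<close>

locale char_0_algebra = nonassoc_algebra scale mult
  for scale :: "'k::field_char_0 \<Rightarrow> 'a::ab_group_add \<Rightarrow> 'a" (infixr "*s" 75)
    and mult :: "'a \<Rightarrow> 'a \<Rightarrow> 'a" (infixl "\<bullet>" 70)
begin

text \<open>Write P(t) for the sum. P(2t) - 2^(n+1) P(t) has no term of degree n+1, and its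
  coefficient at i is \<open>v i\<close> times 2^i - 2^(n+1), a non-zero factor in characteristic
  zero. This lowers the degree. The value t = 0 is excluded because the polynomials below arise
  after cancelling powers of t.\<close>

lemma vector_polynomial_eq_0:
  assumes "\<And>t. t \<noteq> 0 \<Longrightarrow> (\<Sum>i\<le>n. t ^ i *s v i) = 0" "i \<le> n"
  shows "v i = 0"
  using assms
proof (induction n arbitrary: v i)
  case 0
  then show ?case using "0.prems"(1)[of 1] by simp
next
  case (Suc n)
  define w where "w i = (2 ^ i - 2 ^ Suc n) *s v i" for i
  have "(\<Sum>i\<le>n. t ^ i *s w i) = 0" if "t \<noteq> 0" for t
  proof -
    have "(\<Sum>i\<le>n. t ^ i *s w i) = (\<Sum>i\<le>Suc n. t ^ i *s w i)"
      by (simp add: w_def)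
    also have "\<dots> = (\<Sum>i\<le>Suc n. (2 * t) ^ i *s v i) - 2 ^ Suc n *s (\<Sum>i\<le>Suc n. t ^ i *s v i)"
      unfolding w_def scale_sum_right sum_subtractf[symmetric]
      by (rule sum.cong)
        (simp_all add: power_mult_distrib scale_left_diff_distrib scale_right_diff_distrib mult_ac)
    also have "\<dots> = 0"
      using Suc.prems(1)[OF that] Suc.prems(1)[of "2 * t"] that by simp
    finally show ?thesis .
  qed
  then have w0: "w i = 0" if "i \<le> n" for i
    using Suc.IH that by blast
  have v0: "v i = 0" if "i \<le> n" for i
  proof -
    have "(2::'k) ^ i \<noteq> 2 ^ Suc n"
    proof
      assume "(2::'k) ^ i = 2 ^ Suc n"
      then have "of_nat (2 ^ i) = (of_nat (2 ^ Suc n) :: 'k)" by simp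
      then have "(2::nat) ^ i = 2 ^ Suc n" by (simp only: of_nat_eq_iff)
      then have "i = Suc n" by (simp del: power_Suc)
      then show False using that by simp
    qed
    then show ?thesis
      using w0[OF that] by (simp add: w_def)
  qed
  moreover have "v (Suc n) = 0"
    using Suc.prems(1)[of 1] v0 by simp
  ultimately show ?case
    using Suc.prems(2) le_Suc_eq by auto
qed

text \<open>Degree 4 covers both uses: with a left unit, two entries of degree two remain beside a
  constant one; with a two-sided unit, three entries of degree one remain.\<close>

lemma quartic_constant_term_eq_0:
  assumes "\<And>t. t \<noteq> 0 \<Longrightarrow>
    v0 + t *s v1 + t ^ 2 *s v2 + t ^ 3 *s v3 + t ^ 4 *s v4 = 0"
  shows "v0 = 0"
  using vector_polynomial_eq_0[where n = 4 and v = "\<lambda>i. [v0, v1, v2, v3, v4] ! i" and i = 0] assms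
  by (simp add: eval_nat_numeral)

section \<open>Multilinearity of product and associator\<close>

lemma mult_add_right: "x \<bullet> (y + z) = x \<bullet> y + x \<bullet> z"
  and mult_scale_right: "x \<bullet> (s *s y) = s *s (x \<bullet> y)"
  and mult_diff_right: "x \<bullet> (y - z) = x \<bullet> y - x \<bullet> z"
  and mult_zero_right: "x \<bullet> 0 = 0"
proof -
  interpret L: Vector_Spaces.linear scale scale "\<lambda>y. x \<bullet> y" by (rule linear_mult_right)
  show "x \<bullet> (y + z) = x \<bullet> y + x \<bullet> z" "x \<bullet> (s *s y) = s *s (x \<bullet> y)"
    "x \<bullet> (y - z) = x \<bullet> y - x \<bullet> z" "x \<bullet> 0 = 0"
    by (rule L.add L.scale L.diff L.zero)+
qed

lemma mult_add_left: "(y + z) \<bullet> x = y \<bullet> x + z \<bullet> x"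
  and mult_scale_left: "(s *s y) \<bullet> x = s *s (y \<bullet> x)"
  and mult_diff_left: "(y - z) \<bullet> x = y \<bullet> x - z \<bullet> x"
  and mult_zero_left: "0 \<bullet> x = 0"
proof -
  interpret L: Vector_Spaces.linear scale scale "\<lambda>y. y \<bullet> x" by (rule linear_mult_left)
  show "(y + z) \<bullet> x = y \<bullet> x + z \<bullet> x" "(s *s y) \<bullet> x = s *s (y \<bullet> x)"
    "(y - z) \<bullet> x = y \<bullet> x - z \<bullet> x" "0 \<bullet> x = 0"
    by (rule L.add L.scale L.diff L.zero)+
qed

lemmas mult_linear_simps = mult_add_left mult_add_right mult_scale_left mult_scale_right
  mult_diff_left mult_diff_right mult_zero_left mult_zero_right

lemma associator_linear_simps:
  "associator (x + x') y z = associator x y z + associator x' y z"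
  "associator x (y + y') z = associator x y z + associator x y' z"
  "associator x y (z + z') = associator x y z + associator x y z'"
  "associator (s *s x) y z = s *s associator x y z"
  "associator x (s *s y) z = s *s associator x y z"
  "associator x y (s *s z) = s *s associator x y z"
  by (simp_all add: associator_def mult_linear_simps scale_right_diff_distrib)

lemma associator_left_unit:
  assumes "left_unit e"
  shows "associator e x y = 0"
  using assms by (simp add: associator_def left_unit_def)

lemma associator_two_sided_unit:
  assumes "two_sided_unit e"
  shows "associator e x y = 0" "associator x e y = 0" "associator x y e = 0"
  using assms by (simp_all add: associator_def two_sided_unit_def)

section \<open>Consequences of the associator identity near the unit\<close>

lemma algebra_power_left_unit_add:
  assumes "left_unit e" "p \<in> {1, 2}"
  obtains u w where "\<And>t. algebra_power (e + t *s y) p = e + t *s (u + t *s w)"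
proof (cases "p = 2")
  case True
  have "algebra_power (e + t *s y) p = e + t *s ((y + y \<bullet> e) + t *s (y \<bullet> y))" for t
    using assms True
    by (simp add: algebra_power_def left_unit_def mult_linear_simps scale_right_distrib)
  then show ?thesis by (rule that)
next
  case False
  then have "algebra_power (e + t *s y) p = e + t *s (y + t *s 0)" for t
    by (simp add: algebra_power_def)
  then show ?thesis by (rule that)
qed

text \<open>Here the coefficient of t is a multiple of \<open>y\<close>, with \<open>k\<close> equal
  to the exponent and hence invertible in characteristic zero. The lowest term of the expanded
  identity is therefore a non-zero multiple of the associator of three equal entries.\<close>

lemma algebra_power_two_sided_unit_add:
  assumes "two_sided_unit e" "p \<in> {1, 2}"
  obtains k w where "k \<noteq> 0" "\<And>t. algebra_power (e + t *s y) p = e + t *s (k *s y + t *s w)"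
proof (cases "p = 2")
  case True
  have "algebra_power (e + t *s y) p = e + t *s (2 *s y + t *s (y \<bullet> y))" for t
    using assms True scale_left_distrib[of 1 1]
    by (simp add: algebra_power_def two_sided_unit_def mult_linear_simps scale_right_distrib)
  then show ?thesis using that[of 2 "y \<bullet> y"] by simp
next
  case False
  then have "algebra_power (e + t *s y) p = e + t *s (1 *s y + t *s 0)" for t
    by (simp add: algebra_power_def)
  then show ?thesis by (rule that[of 1 0, OF one_neq_zero])
qed

lemma two_sided_unit_if_no_zero_divisors:
  assumes e: "left_unit e" and "no_zero_divisors"
    and qr: "q \<in> {1, 2}" "r \<in> {1, 2}"
    and id: "power_associator_identity 1 q r"
  shows "two_sided_unit e"
proof -
  have "y \<bullet> e = y" for y
  proof -
    obtain u w where q: "\<And>t. algebra_power (e + t *s y) q = e + t *s (u + t *s w)"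
      using algebra_power_left_unit_add[OF e qr(1)] by blast
    obtain u' w' where r: "\<And>t. algebra_power (e + t *s y) r = e + t *s (u' + t *s w')"
      using algebra_power_left_unit_add[OF e qr(2)] by blast
    have "associator y e e
        + t *s (associator y u e + associator y e u')
        + t ^ 2 *s (associator y w e + associator y u u' + associator y e w')
        + t ^ 3 *s (associator y w u' + associator y u w')
        + t ^ 4 *s associator y w w' = 0" if "t \<noteq> 0" for t
    proof -
      have "associator (e + t *s y) (e + t *s (u + t *s w)) (e + t *s (u' + t *s w')) = 0"
        using id unfolding power_associator_identity_def q[symmetric] r[symmetric]
        by (metis algebra_power_1)
      \<comment> \<open>The summand \<open>e\<close> of the first entry contributes nothing because
        \<open>e\<close> is a left unit, so one factor t can be cancelled.\<close>
      then have "t *s associator y (e + t *s (u + t *s w)) (e + t *s (u' + t *s w')) = 0"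
        unfolding associator_linear_simps(1,4) by (simp add: associator_left_unit[OF e])
      then have "associator y (e + t *s (u + t *s w)) (e + t *s (u' + t *s w')) = 0"
        using that by simp
      then show ?thesis
        by (simp add: associator_linear_simps scale_right_distrib eval_nat_numeral algebra_simps)
    qed
    then have "associator y e e = 0"
      by (rule quartic_constant_term_eq_0)
    then have "(y \<bullet> e - y) \<bullet> e = 0"
      using e by (simp add: associator_def left_unit_def mult_linear_simps)
    then have "y \<bullet> e - y = 0 \<or> e = 0"
      using assms(2) unfolding no_zero_divisors_def by blast
    then have "y \<bullet> e = y \<or> e = 0"
      by simp
    \<comment> \<open>If the left unit is 0, the whole algebra is 0.\<close>
    moreover have "y = 0" if "e = 0"
      using e that by (metis left_unit_def mult_zero_left)
    ultimately show ?thesis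
      by (auto simp: mult_zero_left)
  qed
  then show ?thesis
    using e by (simp add: two_sided_unit_def left_unit_def)
qed

lemma square_commutes:
  assumes e: "two_sided_unit e"
    and pqr: "p \<in> {1, 2}" "q \<in> {1, 2}" "r \<in> {1, 2}"
    and id: "power_associator_identity p q r"
  shows "(x \<bullet> x) \<bullet> x = x \<bullet> (x \<bullet> x)"
proof -
  obtain k w where k: "k \<noteq> 0"
    and p: "\<And>t. algebra_power (e + t *s x) p = e + t *s (k *s x + t *s w)"
    using algebra_power_two_sided_unit_add[OF e pqr(1)] by blast
  obtain k' w' where k': "k' \<noteq> 0"
    and q: "\<And>t. algebra_power (e + t *s x) q = e + t *s (k' *s x + t *s w')"
    using algebra_power_two_sided_unit_add[OF e pqr(2)] by blast
  obtain k'' w'' where k'': "k'' \<noteq> 0"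
    and r: "\<And>t. algebra_power (e + t *s x) r = e + t *s (k'' *s x + t *s w'')"
    using algebra_power_two_sided_unit_add[OF e pqr(3)] by blast
  define u u' u'' where u: "u = k *s x" "u' = k' *s x" "u'' = k'' *s x"
  have "associator u u' u''
      + t *s (associator w u' u'' + associator u w' u'' + associator u u' w'')
      + t ^ 2 *s (associator w w' u'' + associator w u' w'' + associator u w' w'')
      + t ^ 3 *s associator w w' w'' + t ^ 4 *s 0 = 0" if "t \<noteq> 0" for t
  proof -
    have "associator (e + t *s (u + t *s w)) (e + t *s (u' + t *s w'))
        (e + t *s (u'' + t *s w'')) = 0"
      using id unfolding power_associator_identity_def u p[symmetric] q[symmetric] r[symmetric]
      by blast
    \<comment> \<open>An entry \<open>e\<close> in any position kills the associator, so each entry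
      yields a factor t.\<close>
    moreover have "associator (e + t *s v) (e + t *s v') (e + t *s v'') =
        t ^ 3 *s associator v v' v''" for v v' v''
      by (simp add: associator_linear_simps associator_two_sided_unit[OF e] eval_nat_numeral)
    ultimately have "associator (u + t *s w) (u' + t *s w') (u'' + t *s w'') = 0"
      using that by simp
    then show ?thesis
      by (simp add: associator_linear_simps scale_right_distrib eval_nat_numeral algebra_simps)
  qed
  then have "associator u u' u'' = 0"
    by (rule quartic_constant_term_eq_0)
  then have "associator x x x = 0"
    using k k' k'' by (simp add: u associator_linear_simps)
  then show ?thesis
    by (simp add: associator_def)
qed

text \<open>The cubic map \<open>f\<close> sending z to [z^2, z] vanishes at x + y and at x - y. Its
  parts of degree one and two in y are \<open>?v\<close> and \<open>?w\<close>; they are separated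
  by the change of sign, and 2 is invertible.\<close>

lemma square_commutes_linearized:
  assumes sq: "\<And>x. (x \<bullet> x) \<bullet> x = x \<bullet> (x \<bullet> x)"
  shows "(x \<bullet> x) \<bullet> y - y \<bullet> (x \<bullet> x) + ((x \<bullet> y + y \<bullet> x) \<bullet> x - x \<bullet> (x \<bullet> y + y \<bullet> x)) = 0"
    (is "?v = 0")
proof -
  let ?w = "(y \<bullet> y) \<bullet> x - x \<bullet> (y \<bullet> y) + ((x \<bullet> y + y \<bullet> x) \<bullet> y - y \<bullet> (x \<bullet> y + y \<bullet> x))"
  define f where "f z = (z \<bullet> z) \<bullet> z - z \<bullet> (z \<bullet> z)" for z
  have f0: "f z = 0" for z
    using sq by (simp add: f_def)
  have "?v + ?w = f (x + y) - f x - f y" "?w - ?v = f (x - y) - f x + f y"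
    by (simp_all add: f_def mult_linear_simps algebra_simps)
  then have "?v + ?w = 0" "?w - ?v = 0"
    by (simp_all only: f0 diff_0_right add_0_right)
  then have "?v + ?v = 0"
    by (metis eq_iff_diff_eq_0)
  then have "2 *s ?v = 0"
    using scale_left_distrib[of 1 1 ?v] by simp
  then show ?thesis
    by simp
qed

section \<open>Generated subalgebras and dimension counts\<close>

lemma in_generated_subalgebra: "x \<in> generated_subalgebra x"
  by (auto simp: generated_subalgebra_def)

lemma generated_subalgebra_subset:
  assumes "subalgebra S" "x \<in> S"
  shows "generated_subalgebra x \<subseteq> S"
  using assms by (auto simp: generated_subalgebra_def)

lemma subalgebra_span:
  assumes "\<And>x y. x \<in> S \<Longrightarrow> y \<in> S \<Longrightarrow> x \<bullet> y \<in> span S"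
  shows "subalgebra (span S)"
proof -
  have base: "x \<bullet> y \<in> span S" if "x \<in> S" "y \<in> span S" for x y
    using that(2)
    by (induction rule: span_induct_alt)
      (auto simp: mult_linear_simps span_zero intro!: span_add span_scale assms that(1))
  have "x \<bullet> y \<in> span S" if "x \<in> span S" "y \<in> span S" for x y
    using that(1)
    by (induction rule: span_induct_alt)
      (auto simp: mult_linear_simps span_zero intro!: span_add span_scale base that(2))
  then show ?thesis
    by (simp add: subalgebra_def)
qed

lemma commute_span:
  assumes "\<And>x y. x \<in> S \<Longrightarrow> y \<in> S \<Longrightarrow> x \<bullet> y = y \<bullet> x"
    and "x \<in> span S" "y \<in> span S"
  shows "x \<bullet> y = y \<bullet> x"
proof -
  have "z \<bullet> y = y \<bullet> z" if "z \<in> S" for z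
    using assms(3)
    by (induction rule: span_induct_alt) (auto simp: mult_linear_simps assms(1) that)
  with assms(2) show ?thesis
    by (induction rule: span_induct_alt) (auto simp: mult_linear_simps)
qed

lemma exists_finite_basis:
  assumes finite_dimensional
  obtains B where "finite_dimensional_vector_space scale B"
proof -
  obtain T where T: "finite T" "span T = UNIV"
    using assms finite_dimensional_def by blast
  obtain B where B: "independent B" "UNIV \<subseteq> span B"
    using maximal_independent_subset[of UNIV] by blast
  have "finite B"
    using independent_span_bound[OF T(1) B(1)] T(2) by simp
  then have "finite_dimensional_vector_space scale B"
    by unfold_locales (use B in auto)
  then show ?thesis
    by (rule that)
qed

lemma subset_span_if_card_ge_dim:
  assumes finite_dimensional "independent S" "S \<subseteq> V" "dim V \<le> card S"
  shows "V \<subseteq> span S"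
proof -
  obtain B where "finite_dimensional_vector_space scale B"
    using exists_finite_basis[OF assms(1)] .
  then interpret finite_dimensional_vector_space scale B .
  show ?thesis
    using card_ge_dim_independent assms(2-4) by blast
qed

section \<open>Bringing the unit into a generated subalgebra\<close>

lemma exists_injective_shift:
  assumes finite_dimensional and e: "two_sided_unit e"
  obtains s where "\<And>z. (x + s *s e) \<bullet> z = 0 \<Longrightarrow> z = 0"
proof (rule ccontr)
  assume "\<not> thesis"
  \<comment> \<open>With the sign reversed, \<open>v s\<close> is an eigenvector of left
    multiplication by \<open>x\<close> for the eigenvalue s itself; every scalar would be an
    eigenvalue.\<close>
  then have "\<forall>s. \<exists>z. z \<noteq> 0 \<and> (x + (- s) *s e) \<bullet> z = 0"
    using that by blast
  then obtain v where v: "\<And>s. v s \<noteq> 0" "\<And>s. (x + (- s) *s e) \<bullet> v s = 0"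
    by metis
  have eig: "x \<bullet> v s = s *s v s" for s
    using v(2)[of s] e by (simp add: mult_linear_simps two_sided_unit_def)
  have inj: "inj v"
  proof
    fix s t assume "v s = v t"
    then have "s *s v s = t *s v s"
      using eig by metis
    then show "s = t"
      using v(1) by simp
  qed
  have "independent (range v)"
    unfolding dependent_explicit
  proof clarify
    fix T c y
    assume T: "finite T" "T \<subseteq> range v" "(\<Sum>y\<in>T. c y *s y) = 0" "y \<in> T" "c y \<noteq> 0"
    \<comment> \<open>The relation is pulled back along the injective \<open>v\<close>, so that it
      is indexed by eigenvalues.\<close>
    obtain S where S: "T = v ` S"
      using T(2) by (auto simp: subset_image_iff)
    have inj_S: "inj_on v S"
      using inj by (rule inj_on_subset) simp
    obtain s where s: "s \<in> S" "y = v s"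
      using T(4) S by blast
    have "c (v s) = 0"
    proof (rule independent_eigenvectors[OF linear_mult_right[of x], where c = "\<lambda>s. c (v s)"])
      show "finite S"
        using T(1) S inj_S by (simp add: finite_image_iff)
      show "(\<Sum>s\<in>S. c (v s) *s v s) = 0"
        using T(3) S inj_S by (simp add: sum.reindex)
    qed (use v eig s in auto)
    then show False
      using T(5) s by simp
  qed
  moreover obtain B where "finite B" "span B = UNIV"
    using assms(1) finite_dimensional_def by blast
  ultimately have "finite (range v)"
    using independent_span_bound[of B "range v"] by simp
  then have "finite (UNIV :: 'k set)"
    using inj finite_imageD by blast
  then show False
    using infinite_UNIV_char_0 by blast
qed

lemma unit_in_generated_subalgebra:
  assumes fd: finite_dimensional and e: "two_sided_unit e"
    and inj: "\<And>z. y \<bullet> z = 0 \<Longrightarrow> z = 0"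
  shows "e \<in> generated_subalgebra y"
proof -
  let ?V = "generated_subalgebra y"
  obtain B where "finite_dimensional_vector_space scale B"
    using exists_finite_basis[OF fd] .
  then interpret fd: finite_dimensional_vector_space scale B .
  interpret L: Vector_Spaces.linear scale scale "\<lambda>z. y \<bullet> z"
    by (rule linear_mult_right)
  have V: "subspace ?V" "\<And>a b. a \<in> ?V \<Longrightarrow> b \<in> ?V \<Longrightarrow> a \<bullet> b \<in> ?V"
    using subalgebra_generated_subalgebra by (auto simp: subalgebra_def)
  have inj_L: "inj (\<lambda>z. y \<bullet> z)"
    unfolding L.inj_iff_eq_0 using inj by blast
  obtain C where C: "C \<subseteq> ?V" "independent C" "?V \<subseteq> span C" "card C = dim ?V"
    using basis_exists[of ?V] by blast
  \<comment> \<open>Surjectivity on \<open>?V\<close> by counting: the image of a basis is an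
    independent subset of \<open>?V\<close> of full size.\<close>
  let ?D = "(\<lambda>z. y \<bullet> z) ` C"
  have "independent ?D"
    using L.independent_injective_image[OF C(2)] inj_L inj_on_subset by blast
  moreover have "card ?D = dim ?V"
    using C(4) inj_L by (metis card_image inj_on_subset subset_UNIV)
  moreover have "?D \<subseteq> ?V"
    using C(1) V(2) in_generated_subalgebra by blast
  ultimately have "?V \<subseteq> span ?D"
    using subset_span_if_card_ge_dim[OF fd] by simp
  also have "span ?D = (\<lambda>z. y \<bullet> z) ` span C"
    by (rule L.span_image)
  finally obtain u where u: "u \<in> span C" "y = y \<bullet> u"
    using in_generated_subalgebra[of y] by blast
  have "u = e"
    using u(2) e inj_L by (metis injD two_sided_unit_def)
  then show ?thesis
    using u(1) span_minimal[OF C(1) V(1)] by blast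
qed

section \<open>Commutativity in dimension at most four\<close>

lemma generated_subalgebra_commute:
  assumes fd: finite_dimensional and deg: "degree \<le> 4"
    and e: "two_sided_unit e" and sq: "\<And>x. (x \<bullet> x) \<bullet> x = x \<bullet> (x \<bullet> x)"
    and eA: "e \<in> generated_subalgebra a"
    and xy: "x \<in> generated_subalgebra a" "y \<in> generated_subalgebra a"
  shows "x \<bullet> y = y \<bullet> x"
proof -
  let ?V = "generated_subalgebra a"
  define b c d where bcd: "b = a \<bullet> a" "c = a \<bullet> b" "d = b \<bullet> b"
  have e_mult: "e \<bullet> z = z" "z \<bullet> e = z" for z
    using e by (simp_all add: two_sided_unit_def)
  have ba: "b \<bullet> a = c"
    using sq[of a] by (simp add: bcd)
  have db: "d \<bullet> b = b \<bullet> d"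
    using sq[of b] by (simp add: bcd)
  \<comment> \<open>The linearised identity at (b, a), where a b and b a are both c.\<close>
  have cbda: "(c \<bullet> b - b \<bullet> c) + (c \<bullet> b - b \<bullet> c) = a \<bullet> d - d \<bullet> a"
    using square_commutes_linearized[OF sq, of b a] ba
    by (simp add: bcd(2,3)[symmetric] mult_linear_simps algebra_simps)
  have ca: "c \<bullet> a = a \<bullet> c"
  proof -
    \<comment> \<open>The linearised identity at (a, b): the commutator of a^2 with b vanishes,
      leaving twice [c, a].\<close>
    have "2 *s (c \<bullet> a - a \<bullet> c) = (c \<bullet> a - a \<bullet> c) + (c \<bullet> a - a \<bullet> c)"
      using scale_left_distrib[of 1 1 "c \<bullet> a - a \<bullet> c"] by simp
    also have "\<dots> = 0"
      using square_commutes_linearized[OF sq, of a b] ba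
      by (simp add: bcd(1,2)[symmetric] mult_linear_simps algebra_simps)
    finally show ?thesis
      by simp
  qed
  \<comment> \<open>Only one of the two commutators has to be killed: [c, b] when \<open>c\<close>
    depends on \<open>e\<close>, \<open>a\<close>, \<open>b\<close>, and [d, a] when it does
    not.\<close>
  have cb_iff: "c \<bullet> b = b \<bullet> c \<longleftrightarrow> d \<bullet> a = a \<bullet> d"
  proof
    assume "d \<bullet> a = a \<bullet> d"
    then have "2 *s (c \<bullet> b - b \<bullet> c) = 0"
      using cbda scale_left_distrib[of 1 1 "c \<bullet> b - b \<bullet> c"] by simp
    then show "c \<bullet> b = b \<bullet> c"
      by simp
  qed (use cbda in simp)
  have inV: "a \<in> ?V" "b \<in> ?V" "c \<in> ?V" "d \<in> ?V"
    using in_generated_subalgebra[of a] subalgebra_generated_subalgebra[of a]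
    by (auto simp: bcd subalgebra_def)
  have dimV: "dim ?V \<le> 4"
    using deg degree_le_iff[OF fd] by blast
  show ?thesis
  proof (cases "b \<in> span {e, a}")
    case True
    have "subalgebra (span {e, a})"
      by (rule subalgebra_span) (use True e_mult in \<open>auto simp: bcd(1)[symmetric] intro: span_base\<close>)
    then have "?V \<subseteq> span {e, a}"
      by (rule generated_subalgebra_subset) (simp add: span_base)
    moreover have "u \<bullet> w = w \<bullet> u" if "u \<in> {e, a}" "w \<in> {e, a}" for u w
      using that e_mult by auto
    ultimately show ?thesis
      using commute_span xy by blast
  next
    case b: False
    have "e \<noteq> 0"
    proof
      assume "e = 0"
      then have "b = 0"
        using e_mult(1)[of b] by (simp add: mult_zero_left)
      then show False
        using b by (simp add: span_zero)
    qed
    moreover have "a \<notin> span {e}"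
    proof
      assume "a \<in> span {e}"
      then obtain k where "a = k *s e"
        by (auto simp: span_singleton)
      then have "b = k *s a"
        by (simp add: bcd mult_linear_simps e_mult)
      then show False
        using b by (simp add: span_base span_scale)
    qed
    ultimately have ind: "independent {b, a, e}"
      using b by (intro independent_insertI) (auto simp: insert_commute independent_empty)
    have dist: "b \<noteq> a" "b \<noteq> e" "a \<noteq> e"
      using b \<open>a \<notin> span {e}\<close> by (auto simp: span_base)
    show ?thesis
    proof (cases "c \<in> span {e, a, b}")
      case c: True
      have eab: "u \<bullet> w = w \<bullet> u" if "u \<in> {e, a, b}" "w \<in> {e, a, b}" for u w
        using that e_mult ba by (auto simp: bcd(2))
      \<comment> \<open>Both factors lie in the span of the pairwise commuting elements
        \<open>e\<close>, \<open>a\<close>, \<open>b\<close>.\<close>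
      have "c \<bullet> b = b \<bullet> c"
        by (rule commute_span[OF eab c]) (simp_all add: span_base)
      then have da: "d \<bullet> a = a \<bullet> d"
        using cb_iff by simp
      show ?thesis
      proof (cases "d \<in> span {e, a, b}")
        case d: True
        have "subalgebra (span {e, a, b})"
          by (rule subalgebra_span)
            (use c d e_mult ba in \<open>auto simp: bcd[symmetric] intro: span_base\<close>)
        then have "?V \<subseteq> span {e, a, b}"
          by (rule generated_subalgebra_subset) (simp add: span_base)
        then show ?thesis
          using commute_span[OF eab] xy by blast
      next
        case d: False
        \<comment> \<open>Four independent elements exhaust \<open>?V\<close>, so commutation need
          only be checked on them.\<close>
        have "independent {d, b, a, e}"
          by (rule independent_insertI[OF _ ind]) (use d in \<open>simp add: insert_commute\<close>)
        moreover have "card {d, b, a, e} = 4"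
        proof -
          have "d \<notin> {b, a, e}" using d by (auto intro: span_base)
          then show ?thesis using dist by simp
        qed
        ultimately have "?V \<subseteq> span {d, b, a, e}"
          using subset_span_if_card_ge_dim[OF fd] inV eA dimV by simp
        moreover have "u \<bullet> w = w \<bullet> u" if "u \<in> {d, b, a, e}" "w \<in> {d, b, a, e}" for u w
          using that e_mult ba da db by (auto simp: bcd(2))
        ultimately show ?thesis
          using commute_span xy by blast
      qed
    next
      case c: False
      have "independent {c, b, a, e}"
        by (rule independent_insertI[OF _ ind]) (use c in \<open>simp add: insert_commute\<close>)
      moreover have "card {c, b, a, e} = 4"
      proof -
        have "c \<notin> {b, a, e}" using c by (auto intro: span_base)
        then show ?thesis using dist by simp
      qed
      ultimately have V: "?V \<subseteq> span {c, b, a, e}"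
        using subset_span_if_card_ge_dim[OF fd] inV eA dimV by simp
      have "d \<in> span {c, b, a, e}"
        using V inV(4) by blast
      \<comment> \<open>\<open>d\<close> is a combination of \<open>c\<close>, \<open>b\<close>,
        \<open>a\<close>, \<open>e\<close>, each of which commutes with \<open>a\<close>.\<close>
      then have "d \<bullet> a = a \<bullet> d"
        by (induction rule: span_induct_alt) (use e_mult ba ca in \<open>auto simp: mult_linear_simps bcd(2)\<close>)
      then have "c \<bullet> b = b \<bullet> c"
        using cb_iff by simp
      then have "u \<bullet> w = w \<bullet> u" if "u \<in> {c, b, a, e}" "w \<in> {c, b, a, e}" for u w
        using that e_mult ba ca by (auto simp: bcd(2))
      then show ?thesis
        using commute_span V xy by blast
    qed
  qed
qed

lemma power_commutative_two_sided_unit: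
  assumes fd: finite_dimensional and deg: "degree \<le> 4"
    and e: "two_sided_unit e" and sq: "\<And>x. (x \<bullet> x) \<bullet> x = x \<bullet> (x \<bullet> x)"
  shows power_commutative
  unfolding power_commutative_def
proof (intro allI ballI)
  fix x u w
  assume uw: "u \<in> generated_subalgebra x" "w \<in> generated_subalgebra x"
  \<comment> \<open>The algebra generated by the shifted element contains both \<open>e\<close> and
    \<open>x\<close>. It still has a single generator, so the degree bound applies to it, with
    \<open>e\<close> available as a basis vector.\<close>
  obtain s where s: "\<And>z. (x + s *s e) \<bullet> z = 0 \<Longrightarrow> z = 0"
    using exists_injective_shift[OF fd e] by blast
  let ?y = "x + s *s e"
  have eA: "e \<in> generated_subalgebra ?y"
    by (rule unit_in_generated_subalgebra[OF fd e s])
  have "?y - s *s e \<in> generated_subalgebra ?y"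
    using subalgebra_generated_subalgebra[of ?y] eA in_generated_subalgebra[of ?y]
    unfolding subalgebra_def by (blast intro: subspace_diff subspace_scale)
  then have "generated_subalgebra x \<subseteq> generated_subalgebra ?y"
    by (intro generated_subalgebra_subset subalgebra_generated_subalgebra) simp
  then show "u \<bullet> w = w \<bullet> u"
    using generated_subalgebra_commute[OF fd deg e sq eA] uw by blast
qed

end

theorem lemma1:
  fixes scale :: "'k::field_char_0 \<Rightarrow> 'a::ab_group_add \<Rightarrow> 'a"
    and mult :: "'a \<Rightarrow> 'a \<Rightarrow> 'a"
    and e :: 'a
  assumes "nonassoc_algebra scale mult"
    and "nonassoc_algebra.finite_dimensional scale"
    and "nonassoc_algebra.degree scale mult \<le> 4"
    and "nonassoc_algebra.left_unit mult e"
  shows "(nonassoc_algebra.two_sided_unit mult e \<and>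
        (\<exists>p\<in>{1, 2}. \<exists>q\<in>{1, 2}. \<exists>r\<in>{1, 2}.
          nonassoc_algebra.power_associator_identity mult p q r) \<longrightarrow>
        nonassoc_algebra.power_commutative scale mult) \<and>
      (nonassoc_algebra.no_zero_divisors mult \<and>
        (\<exists>q\<in>{1, 2}. \<exists>r\<in>{1, 2}.
          nonassoc_algebra.power_associator_identity mult 1 q r) \<longrightarrow>
        nonassoc_algebra.power_commutative scale mult)"
proof -
  interpret char_0_algebra scale mult
    using assms(1) by (simp add: char_0_algebra_def)
  have main: power_commutative
    if "two_sided_unit e" "p \<in> {1, 2}" "q \<in> {1, 2}" "r \<in> {1, 2}"
      "power_associator_identity p q r" for p q r
    using power_commutative_two_sided_unit[OF assms(2,3) that(1) square_commutes[OF that]] .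
  \<comment> \<open>Case (2) becomes case (1) with first exponent 1 once \<open>e\<close> is known
    to be two-sided.\<close>
  moreover have power_commutative
    if "no_zero_divisors" "q \<in> {1, 2}" "r \<in> {1, 2}" "power_associator_identity 1 q r" for q r
    using main[OF two_sided_unit_if_no_zero_divisors[OF assms(4) that] _ that(2-4)] by simp
  ultimately show ?thesis
    by blast
qed

end
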